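(* There exist $v\in W^{1,1}(0,1)$ and a continuous Lagrangian $L\colon[0,1]\times\mathbb{R}\times\mathbb{R}\to[0,\infty)$, $L=L(t,y,p)$, convex in $p$, such that $v$ is a minimizer of $\mathscr{L}$ over $\mathscr{A}_{v(0),v(1)}$ and $0\le\mathscr{L}(v)<\infty$, but $\mathscr{L}(v+u)=\infty$ for all non-zero $u\in W^{1,\infty}_0(0,1)$.
   Context: $\mathscr{L}(u)=\int_0^1L(t,u(t),u'(t))\,dt\in[0,\infty]$ for $u\in W^{1,1}(0,1)$ (real-valued functions, identified with their absolutely continuous representatives on $[0,1]$). $\mathscr{A}_{A,B}=\{u\in W^{1,1}(0,1):u(0)=A,\ u(1)=B\}$. A minimizer of $\mathscr{L}$ over $\mathscr{A}_{A,B}$ is $v\in\mathscr{A}_{A,B}$ with $\mathscr{L}(v)\le\mathscr{L}(u)$ for all $u\in\mathscr{A}_{A,B}$. $W_0^{1,\infty}(0,1)$ is the space of Lipschitz functions on $[0,1]$ vanishing at $0$ and $1$. *)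

theory Defs
  imports "HOL-Analysis.Analysis"
begin

text \<open>
  Functions on \<open>[0,1]\<close> are represented by total functions on the reals; only their values on
  \<open>[0,1]\<close> matter below.
\<close>

definition abs_continuous_on :: "real set \<Rightarrow> (real \<Rightarrow> real) \<Rightarrow> bool" where
  "abs_continuous_on S u \<longleftrightarrow>
    (\<forall>\<epsilon>>0. \<exists>\<delta>>0. \<forall>D.
      finite D \<and> (\<forall>(a, b)\<in>D. a < b \<and> {a..b} \<subseteq> S) \<and>
      disjoint_family_on (\<lambda>(a, b). {a<..<b}) D \<and> (\<Sum>(a, b)\<in>D. b - a) < \<delta>
      \<longrightarrow> (\<Sum>(a, b)\<in>D. \<bar>u b - u a\<bar>) < \<epsilon>)"

text \<open>
  Every element of the Sobolev space \<open>W\<^sup>1\<^sup>,\<^sup>1(0,1)\<close> is identified with its unique absolutely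
  continuous representative on \<open>[0,1]\<close>, so the space is the set of all absolutely continuous
  functions. The weak derivative of such a function is its classical derivative, which exists
  almost everywhere.
\<close>

definition W11 :: "(real \<Rightarrow> real) set" where
  "W11 = {u. abs_continuous_on {0..1} u}"

definition W1inf_0 :: "(real \<Rightarrow> real) set" where
  "W1inf_0 = {u. (\<exists>C. lipschitz_on C {0..1} u) \<and> u 0 = 0 \<and> u 1 = 0}"

text \<open>
  The value of \<^const>\<open>deriv\<close> at a point of non-differentiability is irrelevant for
  \<open>u \<in> W11\<close>, since these points (and the endpoints, where \<^const>\<open>deriv\<close> is two-sided)
  form a null set. The coercion \<^const>\<open>ennreal\<close> is harmless for Lagrangians that are
  nonnegative on \<open>[0,1] \<times> \<real> \<times> \<real>\<close>.
\<close>

definition energy :: "(real \<Rightarrow> real \<Rightarrow> real \<Rightarrow> real) \<Rightarrow> (real \<Rightarrow> real) \<Rightarrow> ennreal" where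
  "energy L u = (\<integral>\<^sup>+t\<in>{0..1}. ennreal (L t (u t) (deriv u t)) \<partial>lebesgue)"

definition admissible :: "real \<Rightarrow> real \<Rightarrow> (real \<Rightarrow> real) set" where
  "admissible A B = {u \<in> W11. u 0 = A \<and> u 1 = B}"

definition is_minimizer ::
  "(real \<Rightarrow> real \<Rightarrow> real \<Rightarrow> real) \<Rightarrow> real \<Rightarrow> real \<Rightarrow> (real \<Rightarrow> real) \<Rightarrow> bool" where
  "is_minimizer L A B v \<longleftrightarrow>
    v \<in> admissible A B \<and> (\<forall>u\<in>admissible A B. energy L v \<le> energy L u)"

end

theory Submission
  imports Defs
begin

text \<open>
  The Lagrangian is \<open>L t y p = \<bar>y - v t\<bar> * p ^ 4\<close>. It vanishes along the graph of \<open>v\<close>, so \<open>v\<close> has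
  energy \<open>0\<close> and is a minimizer for a trivial reason, while the energy of \<open>v + u\<close> is the integral of
  \<open>\<bar>u\<bar> * (v' + u') ^ 4\<close>. A nonzero \<open>u\<close> is bounded away from \<open>0\<close> on some interval, and there \<open>u'\<close> is
  bounded. It remains to choose an absolutely continuous \<open>v\<close> whose derivative has no integrable
  fourth power on any interval. This is done by placing square root singularities on a dense set:
  \<open>v t = (\<Sum>n. (1/2)^n * sqrt (max 0 (t - q n)))\<close>, where \<open>q\<close> enumerates the nonnegative rationals
  (\<open>root_series\<close>). The fourth power makes the divergence visible without integration: near \<open>q n\<close> it
  is so large that the lower bound by a constant on a short interval suffices. Absolute continuity
  holds because the root has a translation invariant modulus of absolute continuity
  (\<open>root_series_abs_continuous\<close>).

  The one delicate point is that the energy is expressed through the pointwise derivative of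
  \<open>v + u\<close>, so this function must be differentiable almost everywhere. After adding a multiple of \<open>t\<close>
  it is monotone, and Lebesgue's theorem on monotone functions applies
  (\<open>mono_continuous_AE_differentiable\<close>), which is derived here from Vitali's covering theorem by
  comparing Stieltjes and Lebesgue measure. Monotonicity also gives the lower bound for the
  derivative (\<open>AE_deriv_root_series_plus_Lipschitz\<close>): as \<open>v\<close> minus any one of its terms is still
  monotone, \<open>v'\<close> is at least the derivative of each term, and the series need not be
  differentiated.
\<close>

section \<open>Vitali coverings of the line and densities of measures\<close>

text \<open>
  The points covered by \<open>P\<close>-intervals in the sense of Vitali. Only intervals with the point in their
  interior are considered: such a set is a \<open>G\<^sub>\<delta>\<close> for every \<open>P\<close>, which spares all questions of
  measurability, and a continuous function has the same derivates along these intervals as along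
  intervals that start or end at the point.
\<close>

definition Vitali_points :: "(real \<Rightarrow> real \<Rightarrow> bool) \<Rightarrow> real set" where
  "Vitali_points P = {x. \<forall>d>0. \<exists>a b. a < x \<and> x < b \<and> b - a < d \<and> P a b}"

lemma Vitali_pointsD:
  assumes "x \<in> Vitali_points P" "0 < d"
  obtains a b where "a < x" "x < b" "b - a < d" "P a b"
  using assms unfolding Vitali_points_def by auto

lemma Vitali_points_borel: "Vitali_points P \<in> sets borel"
proof -
  define I where "I n = {(a, b). b - a < inverse (real (Suc n)) \<and> P a b}" for n
  define G where "G n = (\<Union>i\<in>I n. {fst i<..<snd i})" for n
  have "x \<in> Vitali_points P" if x: "\<And>n. x \<in> G n" for x
    unfolding Vitali_points_def mem_Collect_eq
  proof (intro allI impI)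
    fix d :: real assume "0 < d"
    obtain n where n: "inverse (real (Suc n)) < d" using reals_Archimedean[OF \<open>0 < d\<close>] by blast
    obtain a b where "(a, b) \<in> I n" "a < x" "x < b" using x[of n] unfolding G_def by auto
    moreover from this n have "b - a < d" "P a b" by (auto simp: I_def simp del: of_nat_Suc)
    ultimately show "\<exists>a b. a < x \<and> x < b \<and> b - a < d \<and> P a b" by blast
  qed
  moreover have "x \<in> G n" if "x \<in> Vitali_points P" for x n
  proof -
    have "0 < inverse (real (Suc n))" by simp
    from Vitali_pointsD[OF that this]
    obtain a b where "a < x" "x < b" "b - a < inverse (real (Suc n))" "P a b" .
    then show ?thesis unfolding G_def by (intro UN_I[of "(a, b)"]) (auto simp: I_def)
  qed
  ultimately have eq: "Vitali_points P = (\<Inter>n. G n)"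
    by (intro equalityI subsetI INT_I) (simp_all only: INT_iff UNIV_I simp_thms)
  have "open (G n)" for n unfolding G_def by (intro open_UN ballI open_greaterThanLessThan)
  then show ?thesis unfolding eq by (intro sets.countable_INT) (auto intro: borel_open)
qed

lemma Vitali_covering_open_intervals:
  assumes "open U" "E \<subseteq> U" "E \<subseteq> Vitali_points P"
  obtains C where "countable C"
    "\<forall>(a, b)\<in>C. a < b \<and> P a b \<and> {a<..<b} \<subseteq> U"
    "disjoint_family_on (\<lambda>(a, b). {a<..<b}) C"
    "negligible (E - (\<Union>(a, b)\<in>C. {a<..<b}))"
proof -
  define K where "K = {(a, b). a < b \<and> P a b \<and> {a<..<b} \<subseteq> U}"
  define c r where "c = (\<lambda>(a::real, b). (a + b) / 2)" and "r = (\<lambda>(a::real, b). (b - a) / 2)"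
  have ball: "ball (c i) (r i) = (\<lambda>(a, b). {a<..<b}) i" for i
    by (cases i) (simp add: c_def r_def ball_eq_greaterThanLessThan field_simps)
  have cov: "\<exists>i. i \<in> K \<and> x \<in> ball (c i) (r i) \<and> r i < d" if "x \<in> E" "0 < d" for x d
  proof -
    have "x \<in> U" using that assms by blast
    then obtain e where e: "0 < e" "ball x e \<subseteq> U" using openE[OF assms(1)] by blast
    have "0 < min d e" "x \<in> Vitali_points P" using assms(3) that e by auto
    from Vitali_pointsD[OF this(2,1)]
    obtain a b where ab: "a < x" "x < b" "b - a < min d e" "P a b" .
    have "{a<..<b} \<subseteq> ball x e" using ab by (auto simp: ball_eq_greaterThanLessThan)
    with ab e have "(a, b) \<in> K" by (auto simp: K_def)
    moreover have "x \<in> ball (c (a, b)) (r (a, b))"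
      unfolding ball using ab by simp
    moreover have "r (a, b) < d" using ab by (auto simp: r_def)
    ultimately show ?thesis by blast
  qed
  obtain C where C: "countable C" "C \<subseteq> K"
     "pairwise (\<lambda>i j. disjnt (ball (c i) (r i)) (ball (c j) (r j))) C"
     "negligible (E - (\<Union>i\<in>C. ball (c i) (r i)))"
    by (rule Vitali_covering_theorem_balls[of E K c r, OF cov])
  show thesis
  proof
    show "\<forall>(a, b)\<in>C. a < b \<and> P a b \<and> {a<..<b} \<subseteq> U" using C(2) by (auto simp: K_def)
    show "disjoint_family_on (\<lambda>(a, b). {a<..<b}) C"
      using C(3) unfolding ball pairwise_def disjnt_def disjoint_family_on_def by blast
    show "negligible (E - (\<Union>(a, b)\<in>C. {a<..<b}))" using C(4) unfolding ball .
  qed (fact C(1))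
qed

lemma emeasure_lborel_negligible:
  "negligible N \<Longrightarrow> N \<in> sets borel \<Longrightarrow> emeasure lborel N = 0"
  by (simp add: negligible_iff_null_sets null_sets_completion_iff null_setsD1)

lemma emeasure_disjoint_intervals:
  fixes C :: "(real \<times> real) set"
  assumes "countable C" "disjoint_family_on (\<lambda>(a, b). {a<..<b}) C" "sets M = sets borel"
  shows "emeasure M (\<Union>(a, b)\<in>C. {a<..<b}) = (\<integral>\<^sup>+(a, b). emeasure M {a<..<b} \<partial>count_space C)"
proof -
  have "emeasure M (\<Union>i\<in>C. (\<lambda>(a, b). {a<..<b}) i)
      = (\<integral>\<^sup>+i. emeasure M ((\<lambda>(a, b). {a<..<b}) i) \<partial>count_space C)"
    using assms(1,2) by (intro emeasure_UN_countable) (simp_all add: assms(3) split: prod.split)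
  then show ?thesis by (simp add: split_def)
qed

text \<open>
  The intervals of a disjoint Vitali covering of \<open>E\<close> carry almost all of \<open>E\<close> on the Lebesgue side,
  while on the side of \<open>M\<close> they fit into \<open>U\<close>.
\<close>

lemma Vitali_lower_bound:
  assumes E: "E \<in> sets borel" "E \<subseteq> U" "open U" and M: "sets M = sets borel"
    and V: "E \<subseteq> Vitali_points (\<lambda>a b. k * emeasure lborel {a<..<b} \<le> emeasure M {a<..<b})"
  shows "k * emeasure lborel E \<le> emeasure M U"
proof -
  obtain C where C: "countable C"
    "\<forall>(a, b)\<in>C. a < b \<and> k * emeasure lborel {a<..<b} \<le> emeasure M {a<..<b} \<and> {a<..<b} \<subseteq> U"
    "disjoint_family_on (\<lambda>(a, b). {a<..<b}) C"
    "negligible (E - (\<Union>(a, b)\<in>C. {a<..<b}))"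
    by (rule Vitali_covering_open_intervals[OF E(3,2) V])
  define W where "W = (\<Union>(a, b)\<in>C. {a<..<b})"
  have W: "open W" "W \<subseteq> U"
    unfolding W_def using C(2) by (auto intro!: open_UN)
  have sets [measurable]: "W \<in> sets borel" "E \<in> sets borel" "U \<in> sets borel" "W \<in> sets M" "U \<in> sets M"
    unfolding M using W(1) E(1,3) by (simp_all add: borel_open)
  have "emeasure lborel E \<le> emeasure lborel (W \<union> (E - W))"
    by (rule emeasure_mono) auto
  also have "\<dots> \<le> emeasure lborel W + emeasure lborel (E - W)"
    by (rule emeasure_subadditive) simp_all
  also have "emeasure lborel (E - W) = 0"
    using C(4) unfolding W_def[symmetric] by (rule emeasure_lborel_negligible) measurable
  finally have "k * emeasure lborel E \<le> k * emeasure lborel W" by (simp add: mult_left_mono)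
  also have "\<dots> = (\<integral>\<^sup>+(a, b). k * emeasure lborel {a<..<b} \<partial>count_space C)"
    unfolding W_def emeasure_disjoint_intervals[OF C(1,3) sets_lborel]
    by (subst nn_integral_cmult[symmetric]) (auto simp: split_def)
  also have "\<dots> \<le> (\<integral>\<^sup>+(a, b). emeasure M {a<..<b} \<partial>count_space C)"
    using C(2) by (intro nn_integral_mono) auto
  also have "\<dots> = emeasure M W"
    unfolding W_def emeasure_disjoint_intervals[OF C(1,3) M] ..
  also have "\<dots> \<le> emeasure M U" by (rule emeasure_mono[OF W(2)]) measurable
  finally show ?thesis .
qed

text \<open>
  The same covering for the reverse inequality. Here the comparison bounds \<open>M\<close> only on the union
  \<open>W\<close> of the covering intervals. Its openness is what matters later: a second Vitali covering can
  be carried out inside \<open>W\<close>.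
\<close>

lemma Vitali_upper_bound:
  assumes E: "E \<in> sets borel" "E \<subseteq> U" "open U" and M: "sets M = sets borel"
    and V: "E \<subseteq> Vitali_points (\<lambda>a b. emeasure M {a<..<b} \<le> k * emeasure lborel {a<..<b})"
  obtains W where "open W" "W \<subseteq> U" "emeasure lborel (E - W) = 0"
    "emeasure M W \<le> k * emeasure lborel U"
proof -
  obtain C where C: "countable C"
    "\<forall>(a, b)\<in>C. a < b \<and> emeasure M {a<..<b} \<le> k * emeasure lborel {a<..<b} \<and> {a<..<b} \<subseteq> U"
    "disjoint_family_on (\<lambda>(a, b). {a<..<b}) C"
    "negligible (E - (\<Union>(a, b)\<in>C. {a<..<b}))"
    by (rule Vitali_covering_open_intervals[OF E(3,2) V])
  define W where "W = (\<Union>(a, b)\<in>C. {a<..<b})"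
  have W: "open W" "W \<subseteq> U"
    unfolding W_def using C(2) by (auto intro!: open_UN)
  have sets [measurable]: "W \<in> sets borel" "E \<in> sets borel" "U \<in> sets borel" "W \<in> sets M" "U \<in> sets M"
    unfolding M using W(1) E(1,3) by (simp_all add: borel_open)
  have "emeasure M W = (\<integral>\<^sup>+(a, b). emeasure M {a<..<b} \<partial>count_space C)"
    unfolding W_def emeasure_disjoint_intervals[OF C(1,3) M] ..
  also have "\<dots> \<le> (\<integral>\<^sup>+(a, b). k * emeasure lborel {a<..<b} \<partial>count_space C)"
    using C(2) by (intro nn_integral_mono) auto
  also have "\<dots> = k * emeasure lborel W"
    unfolding W_def emeasure_disjoint_intervals[OF C(1,3) sets_lborel]
    by (subst nn_integral_cmult[symmetric]) (auto simp: split_def)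
  also have "\<dots> \<le> k * emeasure lborel U" by (intro mult_left_mono emeasure_mono[OF W(2)]) simp_all
  finally have "emeasure M W \<le> k * emeasure lborel U" .
  moreover have "emeasure lborel (E - W) = 0"
    using C(4) unfolding W_def[symmetric] by (rule emeasure_lborel_negligible) measurable
  ultimately show thesis using W that by blast
qed

text \<open>
  Let \<open>E\<close> be this set. The upper bound yields an open \<open>W\<close> that contains almost all of \<open>E\<close> and has
  \<open>M\<close>-measure at most \<open>p\<close> times the length of a neighbourhood \<open>U\<close> of \<open>E\<close>; the lower bound, applied
  inside \<open>W\<close>, makes this \<open>M\<close>-measure at least \<open>q\<close> times the length of \<open>E\<close>. Shrinking \<open>U\<close> to \<open>E\<close>
  gives \<open>q \<bar>E\<bar> \<le> p \<bar>E\<bar>\<close>. The window \<open>{-r<..<r}\<close> makes \<open>\<bar>E\<bar>\<close> finite, so that it can be cancelled.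
\<close>

lemma null_distinct_densities:
  fixes p q :: real
  assumes "0 \<le> p" "p < q" and M: "sets M = sets borel"
  shows "emeasure lborel (Vitali_points (\<lambda>a b. emeasure M {a<..<b} \<le> p * emeasure lborel {a<..<b})
    \<inter> Vitali_points (\<lambda>a b. q * emeasure lborel {a<..<b} \<le> emeasure M {a<..<b}) \<inter> {-r<..<r}) = 0"
    (is "emeasure lborel (?P \<inter> ?Q \<inter> _) = 0")
proof -
  define E where "E = ?P \<inter> ?Q \<inter> {-r<..<r}"
  have E: "E \<in> sets borel" unfolding E_def by (intro sets.Int Vitali_points_borel) simp
  have "emeasure lborel E \<le> emeasure lborel {-r<..<r}" unfolding E_def by (rule emeasure_mono) auto
  also have "\<dots> < \<infinity>" by (cases "-r \<le> r") auto
  finally have fin: "emeasure lborel E \<noteq> \<infinity>" by simp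
  have "q * emeasure lborel E \<le> p * (emeasure lborel E + ennreal e)" if e: "0 < e" for e
  proof -
    obtain U where U: "open U" "E \<subseteq> U" "emeasure lborel (U - E) \<le> e"
      using outer_regular_lborel_le[OF E e] .
    have EP: "E \<subseteq> ?P" by (auto simp: E_def)
    obtain W where W: "open W" "W \<subseteq> U" "emeasure lborel (E - W) = 0"
        "emeasure M W \<le> p * emeasure lborel U"
      by (rule Vitali_upper_bound[OF E U(2,1) M EP])
    have "emeasure lborel E = emeasure lborel (E \<inter> W) + emeasure lborel (E - W)"
      using E W by (subst plus_emeasure) (auto intro!: arg_cong[where f="emeasure lborel"])
    then have "q * emeasure lborel E = q * emeasure lborel (E \<inter> W)" using W by simp
    also have "\<dots> \<le> emeasure M W"
      using E W by (intro Vitali_lower_bound M) (auto simp: E_def)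
    also note W(4)
    also have "emeasure lborel U = emeasure lborel E + emeasure lborel (U - E)"
      using E U by (subst plus_emeasure) (auto intro!: arg_cong[where f="emeasure lborel"])
    also have "p * \<dots> \<le> p * (emeasure lborel E + ennreal e)"
      using U by (intro mult_left_mono add_left_mono) auto
    finally show ?thesis .
  qed
  moreover have em: "emeasure lborel E = ennreal (measure lborel E)"
    using fin by (simp add: emeasure_eq_ennreal_measure)
  ultimately have "ennreal (q * measure lborel E) \<le> ennreal (p * (measure lborel E + e))" if "0 < e" for e
    using that assms(1,2) by (simp add: ennreal_mult ennreal_plus)
  then have *: "q * measure lborel E \<le> p * (measure lborel E + e)" if "0 < e" for e
    using that assms(1) by (subst ennreal_le_iff[symmetric]) auto
  have "q * measure lborel E \<le> p * measure lborel E"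
  proof (rule field_le_epsilon)
    fix e :: real assume "0 < e"
    then have "0 < e / (p + 1)" using assms(1) by simp
    then have "q * measure lborel E \<le> p * measure lborel E + p * (e / (p + 1))"
      using *[of "e / (p + 1)"] by (simp add: distrib_left)
    also have "p * (e / (p + 1)) \<le> e" using assms(1) \<open>0 < e\<close> by (simp add: field_simps)
    finally show "q * measure lborel E \<le> p * measure lborel E + e" by simp
  qed
  then have "(q - p) * measure lborel E \<le> 0" by (simp add: algebra_simps)
  then have "measure lborel E \<le> 0" using assms(2) by (simp add: mult_le_0_iff)
  then have "measure lborel E = 0" by (simp add: measure_le_0_iff)
  then show ?thesis using em by (simp add: E_def)
qed

lemma null_infinite_density:
  assumes M: "sets M = sets borel" and fin: "emeasure M {-r<..<r} \<noteq> \<infinity>"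
  shows "emeasure lborel ((\<Inter>n::nat. Vitali_points (\<lambda>a b. of_nat n * emeasure lborel {a<..<b} \<le> emeasure M {a<..<b}))
     \<inter> {-r<..<r}) = 0" (is "emeasure lborel ?E = 0")
proof -
  have E: "?E \<in> sets borel" by (auto intro!: Vitali_points_borel)
  have *: "of_nat n * emeasure lborel ?E \<le> emeasure M {-r<..<r}" for n
    by (rule Vitali_lower_bound[OF E _ _ M]) auto
  show ?thesis
  proof (rule ccontr)
    assume "emeasure lborel ?E \<noteq> 0"
    then have "(SUP n. of_nat n * emeasure lborel ?E) = top"
      by (simp add: SUP_mult_right_ennreal[symmetric] ennreal_SUP_of_nat_eq_top ennreal_top_mult)
    moreover have "(SUP n. of_nat n * emeasure lborel ?E) \<le> emeasure M {-r<..<r}"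
      by (rule SUP_least) (rule *)
    ultimately have "top \<le> emeasure M {-r<..<r}" by (simp only:)
    then show False using fin by (simp add: top_unique)
  qed
qed

section \<open>Lebesgue's differentiation theorem for continuous monotone functions\<close>

text \<open>
  Lebesgue's differentiation theorem for monotone functions, in the continuous case. Let \<open>M\<close> be the
  Stieltjes measure of \<open>F\<close>, so that the slope of \<open>F\<close> over an interval is the ratio of its
  \<open>M\<close>-measure to its length. Outside a null set, the slopes over small intervals around \<open>x\<close> are
  bounded, and no two rationals \<open>p < q\<close> have slopes below \<open>p\<close> and above \<open>q\<close> on arbitrarily small
  scales; then the slopes converge, and continuity carries this over to one-sided difference
  quotients.
\<close>

theorem mono_continuous_AE_differentiable:
  fixes F :: "real \<Rightarrow> real"
  assumes "mono F" "continuous_on UNIV F"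
  shows "AE x in lborel. F differentiable (at x)"
proof -
  define M where "M = interval_measure F"
  have M: "sets M = sets borel" by (simp add: M_def)
  have mono: "x \<le> y \<Longrightarrow> F x \<le> F y" for x y using assms(1) by (rule monoD)
  have cont: "isCont F x" for x using assms(2) by (simp add: continuous_on_eq_continuous_at)
  have Icc: "emeasure M {a..b} = ennreal (F b - F a)" if "a \<le> b" for a b
    unfolding M_def by (rule emeasure_interval_measure_Icc[OF that mono assms(2)])
  have Ioo: "emeasure M {a<..<b} = ennreal (F b - F a)" if "a < b" for a b
  proof -
    have "{a..b} = {a<..<b} \<union> {a..a} \<union> {b..b}" using that by auto
    then have "emeasure M {a..b} \<le> emeasure M ({a<..<b} \<union> {a..a}) + emeasure M {b..b}"
      by (simp only:) (rule emeasure_subadditive; simp add: M)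
    also have "\<dots> \<le> emeasure M {a<..<b} + emeasure M {a..a} + emeasure M {b..b}"
      by (intro add_right_mono emeasure_subadditive) (simp_all add: M)
    finally have "emeasure M {a..b} \<le> emeasure M {a<..<b} + emeasure M {a..a} + emeasure M {b..b}" .
    then have "emeasure M {a..b} \<le> emeasure M {a<..<b}" by (simp only: Icc[OF order_refl] diff_self ennreal_0 add_0_right)
    moreover have "emeasure M {a<..<b} \<le> emeasure M {a..b}"
      by (rule emeasure_mono) (auto simp: M)
    ultimately show ?thesis using Icc[of a b] that by simp
  qed
  define lo hi where "lo p = Vitali_points (\<lambda>a b. emeasure M {a<..<b} \<le> ennreal p * emeasure lborel {a<..<b})"
    and "hi p = Vitali_points (\<lambda>a b. ennreal p * emeasure lborel {a<..<b} \<le> emeasure M {a<..<b})" for p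
  have lo_iff: "x \<in> lo p \<longleftrightarrow> (\<forall>d>0. \<exists>a b. a < x \<and> x < b \<and> b - a < d \<and> F b - F a \<le> p * (b - a))"
    if "0 \<le> p" for x p
    unfolding lo_def Vitali_points_def mem_Collect_eq
    by (intro all_cong imp_cong refl ex_cong1 conj_cong)
       (use that in \<open>simp add: Ioo ennreal_le_iff flip: ennreal_mult\<close>)
  have hi_iff: "x \<in> hi p \<longleftrightarrow> (\<forall>d>0. \<exists>a b. a < x \<and> x < b \<and> b - a < d \<and> p * (b - a) \<le> F b - F a)"
    if "0 \<le> p" for x p
    unfolding hi_def Vitali_points_def mem_Collect_eq
    by (intro all_cong imp_cong refl ex_cong1 conj_cong)
       (use that in \<open>simp add: Ioo mono ennreal_le_iff flip: ennreal_mult\<close>)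
  define N where "N r = (\<Union>(p, q)\<in>{(p, q). p \<in> \<rat> \<and> q \<in> \<rat> \<and> 0 \<le> p \<and> p < q}. lo p \<inter> hi q \<inter> {-r<..<r})
    \<union> ((\<Inter>n::nat. hi (real n)) \<inter> {-r<..<r})" for r
  have "N r \<in> null_sets lborel" for r
  proof -
    have "countable {(p, q). p \<in> (\<rat>::real set) \<and> q \<in> (\<rat>::real set) \<and> 0 \<le> p \<and> p < q}"
      by (rule countable_subset[of _ "\<rat> \<times> \<rat>"]) (auto intro: countable_rat)
    moreover have "lo p \<inter> hi q \<inter> {-r<..<r} \<in> null_sets lborel" if "0 \<le> p" "p < q" for p q
      using null_distinct_densities[OF that M, of r] unfolding lo_def hi_def
      by (intro null_setsI) (auto intro!: Vitali_points_borel)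
    moreover have "(\<Inter>n::nat. hi (real n)) \<inter> {-r<..<r} \<in> null_sets lborel"
    proof -
      have "emeasure M {-r<..<r} \<noteq> \<infinity>" by (cases "-r < r") (auto simp: Ioo)
      from null_infinite_density[OF M this] show ?thesis unfolding hi_def
        by (intro null_setsI) (auto intro!: Vitali_points_borel simp: ennreal_of_nat_eq_real_of_nat)
    qed
    ultimately show ?thesis unfolding N_def
      by (intro null_sets.Un null_sets_UN') auto
  qed
  then have null: "(\<Union>r::nat. N (real r)) \<in> null_sets lborel" by (intro null_sets_UN)
  have "F differentiable (at x)" if x: "\<And>r::nat. x \<notin> N (real r)" for x
  proof -
    obtain r :: nat where "\<bar>x\<bar> < real r" using reals_Archimedean2 by blast
    then have r: "x \<in> {-real r<..<real r}" by auto
    have not_hi: "\<exists>n::nat. x \<notin> hi (real n)" using x[of r] r by (auto simp: N_def)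
    have gap: "x \<notin> lo p \<or> x \<notin> hi q" if "p \<in> \<rat>" "q \<in> \<rat>" "0 \<le> p" "p < q" for p q
      using x[of r] r that by (auto simp: N_def)
    \<comment> \<open>\<open>l\<close> is the upper limit of the slopes around \<open>x\<close>: the derivative to be.\<close>
    define Q where "Q = {q. 0 \<le> q \<and> x \<notin> hi q}"
    define l where "l = Inf Q"
    obtain n where "x \<notin> hi (real n)" using not_hi by blast
    then have "real n \<in> Q" by (simp add: Q_def)
    then have Q: "Q \<noteq> {}" by blast
    have Q_bdd: "bdd_below Q" by (auto simp: Q_def intro!: bdd_belowI[of _ 0])
    have l0: "0 \<le> l" unfolding l_def using Q by (intro cInf_greatest) (auto simp: Q_def)
    have upper: "\<exists>d>0. \<forall>a b. a < x \<and> x < b \<and> b - a < d \<longrightarrow> F b - F a \<le> (l + e) * (b - a)" if "0 < e" for e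
    proof -
      obtain q where q: "q \<in> Q" "q < l + e"
        using cInf_lessD[OF Q, of "l + e"] \<open>0 < e\<close> unfolding l_def by auto
      then obtain d where d: "0 < d" "\<And>a b. a < x \<Longrightarrow> x < b \<Longrightarrow> b - a < d \<Longrightarrow> F b - F a < q * (b - a)"
        using hi_iff[of q x] unfolding Q_def by (auto simp: not_le)
      show ?thesis
      proof (intro exI conjI allI impI)
        fix a b assume ab: "a < x \<and> x < b \<and> b - a < d"
        then have "F b - F a < q * (b - a)" using d(2) by blast
        also have "\<dots> \<le> (l + e) * (b - a)" using q ab by (intro mult_right_mono) auto
        finally show "F b - F a \<le> (l + e) * (b - a)" by simp
      qed (fact d(1))
    qed
    have lower: "\<exists>d>0. \<forall>a b. a < x \<and> x < b \<and> b - a < d \<longrightarrow> (l - e) * (b - a) \<le> F b - F a" if "0 < e" for e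
    proof (cases "l - e < 0")
      case True
      have "(l - e) * (b - a) \<le> F b - F a" if "a < x" "x < b" for a b
        using True that mono[of a b] mult_nonpos_nonneg[of "l - e" "b - a"] by linarith
      then show ?thesis by (intro exI[of _ 1]) auto
    next
      case False
      obtain p where p: "p \<in> \<rat>" "l - e < p" "p < l" using Rats_dense_in_real[of "l - e" l] \<open>0 < e\<close> by auto
      obtain q where q: "q \<in> \<rat>" "p < q" "q < l" using Rats_dense_in_real[of p l] p by auto
      have "q \<notin> Q" using q cInf_lower[OF _ Q_bdd, of q] unfolding l_def by force
      then have "x \<in> hi q" using False p q by (simp add: Q_def)
      then have "x \<notin> lo p" using gap[of p q] p q False by auto
      then obtain d where d: "0 < d" "\<And>a b. a < x \<Longrightarrow> x < b \<Longrightarrow> b - a < d \<Longrightarrow> p * (b - a) < F b - F a"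
        using lo_iff[of p x] p False by (auto simp: not_le) (meson not_le)
      show ?thesis
      proof (intro exI conjI allI impI)
        fix a b assume ab: "a < x \<and> x < b \<and> b - a < d"
        then have "(l - e) * (b - a) \<le> p * (b - a)" using p by (intro mult_right_mono) auto
        also have "\<dots> < F b - F a" using d(2) ab by blast
        finally show "(l - e) * (b - a) \<le> F b - F a" by simp
      qed (fact d(1))
    qed
    have straddle: "\<exists>d>0. \<forall>a b. a < x \<and> x < b \<and> b - a < d \<longrightarrow> \<bar>F b - F a - l * (b - a)\<bar> \<le> e * (b - a)"
      if "0 < e" for e
    proof -
      obtain d1 d2 where d: "0 < d1" "0 < d2"
        "\<And>a b. a < x \<and> x < b \<and> b - a < d1 \<Longrightarrow> F b - F a \<le> (l + e) * (b - a)"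
        "\<And>a b. a < x \<and> x < b \<and> b - a < d2 \<Longrightarrow> (l - e) * (b - a) \<le> F b - F a"
        using upper[OF \<open>0 < e\<close>] lower[OF \<open>0 < e\<close>] by (elim exE conjE) blast
      show ?thesis
      proof (intro exI[of _ "min d1 d2"] conjI allI impI)
        fix a b assume "a < x \<and> x < b \<and> b - a < min d1 d2"
        then show "\<bar>F b - F a - l * (b - a)\<bar> \<le> e * (b - a)"
          using d(3)[of a b] d(4)[of a b] by (simp add: abs_le_iff algebra_simps)
      qed (use d in simp)
    qed
    have "(F has_derivative (\<lambda>h. l * h)) (at x)"
      unfolding has_derivative_at_alt
    proof (intro conjI allI impI bounded_linear_mult_right)
      fix e :: real assume "0 < e"
      then obtain d where d: "0 < d"
        "\<forall>a b. a < x \<and> x < b \<and> b - a < d \<longrightarrow> \<bar>F b - F a - l * (b - a)\<bar> \<le> e * (b - a)"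
        using straddle[OF \<open>0 < e\<close>] by blast
      \<comment> \<open>Let the other end of a straddling interval tend to \<open>x\<close>.\<close>
      have right: "\<bar>F b - F x - l * (b - x)\<bar> \<le> e * (b - x)" if "x < b" "b - x < d" for b
      proof (rule tendsto_le)
        show "((\<lambda>a. \<bar>F b - F a - l * (b - a)\<bar>) \<longlongrightarrow> \<bar>F b - F x - l * (b - x)\<bar>) (at_left x)"
          using cont[of x] by (intro tendsto_intros) (simp_all add: isCont_def filterlim_at_split)
        show "((\<lambda>a. e * (b - a)) \<longlongrightarrow> e * (b - x)) (at_left x)" by (intro tendsto_intros)
        show "\<forall>\<^sub>F a in at_left x. \<bar>F b - F a - l * (b - a)\<bar> \<le> e * (b - a)"
          unfolding eventually_at_left_field
          using that d(2) by (intro exI[of _ "b - d"]) auto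
      qed simp
      have left: "\<bar>F x - F a - l * (x - a)\<bar> \<le> e * (x - a)" if "a < x" "x - a < d" for a
      proof (rule tendsto_le)
        show "((\<lambda>b. \<bar>F b - F a - l * (b - a)\<bar>) \<longlongrightarrow> \<bar>F x - F a - l * (x - a)\<bar>) (at_right x)"
          using cont[of x] by (intro tendsto_intros) (simp_all add: isCont_def filterlim_at_split)
        show "((\<lambda>b. e * (b - a)) \<longlongrightarrow> e * (x - a)) (at_right x)" by (intro tendsto_intros)
        show "\<forall>\<^sub>F b in at_right x. \<bar>F b - F a - l * (b - a)\<bar> \<le> e * (b - a)"
          unfolding eventually_at_right_field
          using that d(2) by (intro exI[of _ "a + d"]) auto
      qed simp
      show "\<exists>d>0. \<forall>y. norm (y - x) < d \<longrightarrow> norm (F y - F x - l * (y - x)) \<le> e * norm (y - x)"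
      proof (intro exI[of _ d] conjI allI impI)
        fix y assume y: "norm (y - x) < d"
        consider "y < x" | "y = x" | "x < y" by linarith
        then show "norm (F y - F x - l * (y - x)) \<le> e * norm (y - x)"
        proof cases
          case 1
          have "F y - F x - l * (y - x) = - (F x - F y - l * (x - y))" by (simp add: algebra_simps)
          then show ?thesis using left[of y] 1 y by simp
        qed (use right[of y] y in auto)
      qed (fact d(1))
    qed
    then show ?thesis unfolding differentiable_def by blast
  qed
  then show ?thesis using null by (intro AE_I'[of "\<Union>r::nat. N (real r)"]) auto
qed

section \<open>Absolutely continuous functions\<close>

lemma abs_continuous_on_subset:
  assumes "abs_continuous_on S u" "T \<subseteq> S"
  shows "abs_continuous_on T u"
  unfolding abs_continuous_on_def
proof (intro allI impI)
  fix \<epsilon> :: real assume "0 < \<epsilon>"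
  then obtain \<delta> where \<delta>: "0 < \<delta>" and *: "\<And>D. finite D \<and> (\<forall>(a, b)\<in>D. a < b \<and> {a..b} \<subseteq> S) \<and>
      disjoint_family_on (\<lambda>(a, b). {a<..<b}) D \<and> (\<Sum>(a, b)\<in>D. b - a) < \<delta>
      \<Longrightarrow> (\<Sum>(a, b)\<in>D. \<bar>u b - u a\<bar>) < \<epsilon>"
    using assms(1)[unfolded abs_continuous_on_def, rule_format, OF \<open>0 < \<epsilon>\<close>] by auto
  show "\<exists>\<delta>>0. \<forall>D. finite D \<and> (\<forall>(a, b)\<in>D. a < b \<and> {a..b} \<subseteq> T) \<and>
      disjoint_family_on (\<lambda>(a, b). {a<..<b}) D \<and> (\<Sum>(a, b)\<in>D. b - a) < \<delta>
      \<longrightarrow> (\<Sum>(a, b)\<in>D. \<bar>u b - u a\<bar>) < \<epsilon>"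
  proof (intro exI[of _ \<delta>] conjI allI impI)
    fix D assume D: "finite D \<and> (\<forall>(a, b)\<in>D. a < b \<and> {a..b} \<subseteq> T) \<and>
      disjoint_family_on (\<lambda>(a, b). {a<..<b}) D \<and> (\<Sum>(a, b)\<in>D. b - a) < \<delta>"
    then have "\<forall>(a, b)\<in>D. a < b \<and> {a..b} \<subseteq> S" using assms(2) by blast
    with D show "(\<Sum>(a, b)\<in>D. \<bar>u b - u a\<bar>) < \<epsilon>" by (intro *) blast
  qed (fact \<delta>)
qed

lemma abs_continuous_on_imp_continuous:
  assumes "abs_continuous_on UNIV u"
  shows "continuous_on UNIV u"
  unfolding continuous_on_iff
proof (intro ballI allI impI)
  fix x \<epsilon> :: real assume "0 < \<epsilon>"
  then obtain \<delta> where \<delta>: "0 < \<delta>" and *: "\<And>D. finite D \<and> (\<forall>(a, b)\<in>D. a < b \<and> {a..b} \<subseteq> UNIV) \<and>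
      disjoint_family_on (\<lambda>(a, b). {a<..<b}) D \<and> (\<Sum>(a, b)\<in>D. b - a) < \<delta>
      \<Longrightarrow> (\<Sum>(a, b)\<in>D. \<bar>u b - u a\<bar>) < \<epsilon>"
    using assms[unfolded abs_continuous_on_def, rule_format, OF \<open>0 < \<epsilon>\<close>] by auto
  have **: "\<bar>u b - u a\<bar> < \<epsilon>" if "a < b" "b - a < \<delta>" for a b
    using *[of "{(a, b)}"] that by (simp add: disjoint_family_on_def)
  have "dist (u y) (u x) < \<epsilon>" if "dist y x < \<delta>" for y
    using that **[of x y] **[of y x] \<open>0 < \<epsilon>\<close>
    by (cases x y rule: linorder_cases) (auto simp: dist_real_def abs_minus_commute)
  with \<delta> show "\<exists>d>0. \<forall>x'\<in>UNIV. dist x' x < d \<longrightarrow> dist (u x') (u x) < \<epsilon>" by blast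
qed

section \<open>A series of square roots with dense singularities\<close>

text \<open>
  Disjoint intervals can be peeled off from the right: whatever remains lies to the left of the
  last interval.
\<close>

lemma sum_increments_le_mono:
  fixes h :: "real \<Rightarrow> real"
  assumes h: "mono h" "\<And>x. m \<le> h x"
    and D: "finite D" "\<forall>(a, b)\<in>D. a < b" "disjoint_family_on (\<lambda>(a, b). {a<..<b}) D"
    and c: "\<forall>(a, b)\<in>D. b \<le> c"
  shows "(\<Sum>(a, b)\<in>D. h b - h a) \<le> h c - m"
  using D c
proof (induction "card D" arbitrary: D c rule: less_induct)
  case less
  show ?case
  proof (cases "D = {}")
    case True
    then show ?thesis using h(2) by simp
  next
    case False
    have "Max (snd ` D) \<in> snd ` D" using False less.prems by (intro Max_in) auto
    then obtain a b where ab: "(a, b) \<in> D" "b = Max (snd ` D)" by auto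
    have max: "b' \<le> b" if "(a', b') \<in> D" for a' b'
    proof -
      have "b' \<in> snd ` D" using that by force
      then show ?thesis unfolding ab(2) using less.prems(1) by (intro Max_ge) auto
    qed
    define D' where "D' = D - {(a, b)}"
    have left: "b' \<le> a" if "(a', b') \<in> D'" for a' b'
    proof (rule ccontr)
      assume "\<not> b' \<le> a"
      moreover have "a' < b'" "a < b" "b' \<le> b"
        using that ab less.prems(2) max unfolding D'_def by auto
      ultimately have "(max a a' + b') / 2 \<in> {a<..<b} \<inter> {a'<..<b'}" by auto
      moreover have "{a<..<b} \<inter> {a'<..<b'} = {}"
        using disjoint_family_onD[OF less.prems(3), of "(a, b)" "(a', b')"] that ab unfolding D'_def by auto
      ultimately show False by blast
    qed
    have "(\<Sum>(a, b)\<in>D'. h b - h a) \<le> h a - m"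
    proof (rule less.hyps)
      show "card D' < card D" unfolding D'_def using ab(1) less.prems(1) by (intro card_Diff1_less)
      show "disjoint_family_on (\<lambda>(a, b). {a<..<b}) D'"
        using less.prems(3) by (rule disjoint_family_on_mono[rotated]) (auto simp: D'_def)
    qed (use less.prems left in \<open>auto simp: D'_def\<close>)
    moreover have "(\<Sum>(a, b)\<in>D. h b - h a) = (h b - h a) + (\<Sum>(a, b)\<in>D'. h b - h a)"
      unfolding D'_def using less.prems(1) ab(1) by (subst sum.remove[of D "(a, b)"]) auto
    moreover have "h b \<le> h c" using less.prems(4) ab(1) h(1) by (auto dest: monoD)
    ultimately show ?thesis by linarith
  qed
qed

text \<open>
  The value \<open>0\<close> to the left of \<open>0\<close> bounds the translates \<open>pos_sqrt (t - q)\<close> with \<open>0 \<le> q\<close> by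
  \<open>pos_sqrt t\<close>, and it gives the truncation \<open>min (pos_sqrt x) m\<close> the total variation \<open>m\<close>.
\<close>

definition pos_sqrt :: "real \<Rightarrow> real" where
  "pos_sqrt x = sqrt (max 0 x)"

lemma pos_sqrt_mono: "mono pos_sqrt"
  by (intro monoI) (simp add: pos_sqrt_def max.coboundedI2)

lemma pos_sqrt_nonneg [simp]: "0 \<le> pos_sqrt x"
  by (simp add: pos_sqrt_def)

text \<open>
  The root is split at height \<open>m\<close>: the truncation has total variation \<open>m\<close>, and the part above is
  Lipschitz with constant \<open>1 / m\<close>. This makes the root absolutely continuous, with a modulus
  that does not change under translation.
\<close>

lemma pos_sqrt_increment:
  assumes "a \<le> b" "0 < m"
  shows "pos_sqrt b - pos_sqrt a \<le> (min (pos_sqrt b) m - min (pos_sqrt a) m) + (b - a) / m"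
proof -
  define r s where "r = pos_sqrt a" and "s = pos_sqrt b"
  have rs: "0 \<le> r" "r \<le> s" using assms(1) pos_sqrt_mono by (auto simp: r_def s_def dest: monoD)
  have sq: "s\<^sup>2 - r\<^sup>2 \<le> b - a"
    using assms(1) by (auto simp: r_def s_def pos_sqrt_def max_def)
  consider "s \<le> m" | "r \<le> m" "m < s" | "m < r" by linarith
  then have "s - r \<le> (min s m - min r m) + (b - a) / m"
  proof cases
    case 1
    then show ?thesis using rs assms by simp
  next
    case 2
    have "(s - m) * m \<le> (s - m) * (s + m)" using 2 assms by (intro mult_left_mono) auto
    also have "\<dots> = s\<^sup>2 - m\<^sup>2" by (simp add: power2_eq_square algebra_simps)
    also have "\<dots> \<le> s\<^sup>2 - r\<^sup>2" using 2 rs by (simp add: power_mono)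
    finally have "(s - m) * m \<le> b - a" using sq by linarith
    then have "s - m \<le> (b - a) / m" using assms by (simp add: pos_le_divide_eq)
    then show ?thesis using 2 by simp
  next
    case 3
    have "(s - r) * m \<le> (s - r) * (s + r)" using 3 rs assms by (intro mult_left_mono) auto
    also have "\<dots> = s\<^sup>2 - r\<^sup>2" by (simp add: power2_eq_square algebra_simps)
    finally have "(s - r) * m \<le> b - a" using sq by linarith
    then have "s - r \<le> (b - a) / m" using assms by (simp add: pos_le_divide_eq)
    then show ?thesis using 3 rs by simp
  qed
  then show ?thesis by (simp add: r_def s_def)
qed

lemma pos_sqrt_sum_increments:
  assumes D: "finite D" "\<forall>(a, b)\<in>D. a < b" "disjoint_family_on (\<lambda>(a, b). {a<..<b}) D"
    and m: "0 < m"
  shows "(\<Sum>(a, b)\<in>D. pos_sqrt (b - q) - pos_sqrt (a - q)) \<le> m + (\<Sum>(a, b)\<in>D. b - a) / m"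
proof -
  define h where "h x = min (pos_sqrt (x - q)) m" for x
  have "mono h"
    unfolding h_def by (intro monoI min.mono monoD[OF pos_sqrt_mono]) auto
  obtain c where c: "\<forall>i\<in>D. snd i \<le> c"
    using D(1) finite_imageI[of D snd] bdd_above_finite[of "snd ` D"] unfolding bdd_above_def by auto
  have "(\<Sum>(a, b)\<in>D. pos_sqrt (b - q) - pos_sqrt (a - q)) \<le> (\<Sum>(a, b)\<in>D. (h b - h a) + (b - a) / m)"
    using D(2) pos_sqrt_increment[of "_ - q" "_ - q" m] m unfolding h_def
    by (intro sum_mono) fastforce
  also have "\<dots> = (\<Sum>(a, b)\<in>D. h b - h a) + (\<Sum>(a, b)\<in>D. b - a) / m"
    by (simp add: split_def sum.distrib sum_divide_distrib)
  also have "(\<Sum>(a, b)\<in>D. h b - h a) \<le> h c - 0"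
    using D c m by (intro sum_increments_le_mono \<open>mono h\<close>) (auto simp: h_def)
  also have "h c \<le> m" by (simp add: h_def)
  finally show ?thesis by simp
qed

text \<open>
  For nonnegative \<open>q n\<close> the series converges, and it inherits the infinite right-hand slope of the
  root at every \<open>q n\<close>.
\<close>

definition root_series :: "(nat \<Rightarrow> real) \<Rightarrow> real \<Rightarrow> real" where
  "root_series q t = (\<Sum>n. (1/2)^n * pos_sqrt (t - q n))"

lemma root_series_summable:
  assumes "\<And>n. 0 \<le> q n"
  shows "summable (\<lambda>n. (1/2)^n * pos_sqrt (t - q n))"
proof (rule summable_comparison_test')
  show "summable (\<lambda>n. (1/2)^n * pos_sqrt t)" by (intro summable_mult2 summable_geometric) simp
  show "norm ((1/2)^n * pos_sqrt (t - q n)) \<le> (1/2)^n * pos_sqrt t" if "0 \<le> n" for n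
    using monoD[OF pos_sqrt_mono, of "t - q n" t] assms[of n] by (simp add: abs_mult)
qed

text \<open>
  Removing one term of the series leaves a monotone function, so the singularity of that term
  survives in the sum.
\<close>

lemma root_series_increment:
  assumes "\<And>n. 0 \<le> q n" "a \<le> b"
  shows "(1/2)^n * (pos_sqrt (b - q n) - pos_sqrt (a - q n)) \<le> root_series q b - root_series q a"
proof -
  let ?f = "\<lambda>n. (1/2)^n * pos_sqrt (b - q n) - (1/2)^n * pos_sqrt (a - q n)"
  have sum: "summable ?f" by (intro summable_diff root_series_summable assms)
  have "sum ?f {n} \<le> suminf ?f"
    using assms(2) by (intro sum_le_suminf sum) (auto intro: monoD[OF pos_sqrt_mono])
  also have "\<dots> = root_series q b - root_series q a"
    unfolding root_series_def by (intro suminf_diff[symmetric] root_series_summable assms)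
  finally show ?thesis by (simp add: right_diff_distrib)
qed

lemma root_series_mono:
  assumes "\<And>n. 0 \<le> q n"
  shows "mono (root_series q)"
proof (rule monoI)
  fix a b :: real assume "a \<le> b"
  then have "0 \<le> (1/2)^0 * (pos_sqrt (b - q 0) - pos_sqrt (a - q 0))"
    using monoD[OF pos_sqrt_mono, of "a - q 0" "b - q 0"] by simp
  then show "root_series q a \<le> root_series q b"
    using root_series_increment[where q = q and n = 0, OF assms \<open>a \<le> b\<close>] by linarith
qed

text \<open>
  The estimate of \<open>pos_sqrt_sum_increments\<close> is uniform in \<open>q\<close>, so it may be summed against the
  weights \<open>(1/2)^n\<close>, whose total is \<open>2\<close>. With \<open>\<delta> = m\<^sup>2\<close> both parts of that estimate are at most
  \<open>m\<close>, which adds up to \<open>4 m\<close>.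
\<close>

lemma root_series_abs_continuous:
  assumes q: "\<And>n. 0 \<le> q n"
  shows "abs_continuous_on UNIV (root_series q)"
  unfolding abs_continuous_on_def
proof (intro allI impI)
  fix \<epsilon> :: real assume \<epsilon>: "0 < \<epsilon>"
  define m where "m = \<epsilon> / 5"
  have m: "0 < m" using \<epsilon> by (simp add: m_def)
  have "(\<Sum>(a, b)\<in>D. \<bar>root_series q b - root_series q a\<bar>) < \<epsilon>"
    if D: "finite D" "\<forall>(a, b)\<in>D. a < b" "disjoint_family_on (\<lambda>(a, b). {a<..<b}) D"
      and len: "(\<Sum>(a, b)\<in>D. b - a) < m\<^sup>2" for D
  proof -
    let ?f = "\<lambda>n i. (1/2)^n * pos_sqrt (snd i - q n) - (1/2)^n * pos_sqrt (fst i - q n)"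
    have summ: "summable (\<lambda>n. ?f n i)" for i by (intro summable_diff root_series_summable q)
    have "(\<Sum>(a, b)\<in>D. \<bar>root_series q b - root_series q a\<bar>) = (\<Sum>i\<in>D. \<Sum>n. ?f n i)"
    proof (rule sum.cong[OF refl])
      fix i assume "i \<in> D"
      moreover obtain a b where "i = (a, b)" by force
      ultimately show "(case i of (a, b) \<Rightarrow> \<bar>root_series q b - root_series q a\<bar>) = (\<Sum>n. ?f n i)"
        using D(2) monoD[OF root_series_mono[where q = q, OF q], of a b]
        by (auto simp: root_series_def suminf_diff[symmetric] root_series_summable q)
    qed
    also have "\<dots> = (\<Sum>n. \<Sum>i\<in>D. ?f n i)" by (rule suminf_sum[symmetric, OF summ])
    also have "\<dots> \<le> (\<Sum>n. (1/2)^n * (2 * m))"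
    proof (rule suminf_le)
      fix n
      have "(\<Sum>i\<in>D. ?f n i) = (1/2)^n * (\<Sum>(a, b)\<in>D. pos_sqrt (b - q n) - pos_sqrt (a - q n))"
        by (simp add: sum_distrib_left right_diff_distrib split_def)
      also have "\<dots> \<le> (1/2)^n * (m + (\<Sum>(a, b)\<in>D. b - a) / m)"
        by (intro mult_left_mono pos_sqrt_sum_increments D m) auto
      also have "\<dots> \<le> (1/2)^n * (2 * m)"
        using len m by (intro mult_left_mono) (simp_all add: pos_divide_le_eq power2_eq_square)
      finally show "(\<Sum>i\<in>D. ?f n i) \<le> (1/2)^n * (2 * m)" .
      show "summable (\<lambda>n. \<Sum>i\<in>D. ?f n i)" by (intro summable_sum summ)
      show "summable (\<lambda>n. (1/2)^n * (2 * m))" by (intro summable_mult2 summable_geometric) simp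
    qed
    also have "\<dots> = 4 * m"
      by (subst suminf_mult2[symmetric]) (simp_all add: summable_geometric suminf_geometric)
    also have "\<dots> < \<epsilon>" using \<epsilon> by (simp add: m_def)
    finally show ?thesis .
  qed
  then show "\<exists>\<delta>>0. \<forall>D. finite D \<and> (\<forall>(a, b)\<in>D. a < b \<and> {a..b} \<subseteq> UNIV) \<and>
      disjoint_family_on (\<lambda>(a, b). {a<..<b}) D \<and> (\<Sum>(a, b)\<in>D. b - a) < \<delta>
      \<longrightarrow> (\<Sum>(a, b)\<in>D. \<bar>root_series q b - root_series q a\<bar>) < \<epsilon>"
    using m by (intro exI[of _ "m\<^sup>2"]) auto
qed

section \<open>Lipschitz perturbations have infinite energy\<close>

lemma DERIV_pos_sqrt:
  assumes "q < x"
  shows "((\<lambda>x. pos_sqrt (x - q)) has_real_derivative (1 / (2 * sqrt (x - q)))) (at x)"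
proof -
  have "((\<lambda>x. sqrt (x - q)) has_real_derivative (1 / (2 * sqrt (x - q)))) (at x)"
    using assms by (auto intro!: derivative_eq_intros simp: field_simps)
  then show ?thesis
    by (rule has_field_derivative_transform_within_open[of _ _ _ "{q<..}"])
       (use assms in \<open>auto simp: pos_sqrt_def\<close>)
qed

text \<open>
  Adding \<open>C * t\<close> makes the Lipschitz function \<open>u\<close> nondecreasing. The sum \<open>F\<close> of this function and
  \<open>root_series q\<close> is therefore monotone and continuous, hence differentiable almost everywhere, and
  so is \<open>root_series q + u\<close>. \<open>F\<close> stays monotone when the \<open>n\<close>-th term of the series is subtracted, so
  \<open>F'\<close> is at least the derivative of this term; the loss of \<open>C\<close> comes from the summand \<open>C * t\<close>.
\<close>

lemma AE_deriv_root_series_plus_Lipschitz: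
  assumes q: "\<And>n. 0 \<le> q n" and u: "C-lipschitz_on {0..1} u"
  shows "AE x in lebesgue. q n < x \<and> 0 < x \<and> x < 1 \<longrightarrow>
    (1/2)^n / (2 * sqrt (x - q n)) - C \<le> deriv (\<lambda>t. root_series q t + u t) x"
proof -
  \<comment> \<open>\<open>u\<close> is controlled on the unit interval only: clamp the argument to it.\<close>
  define cl where "cl t = min 1 (max 0 t)" for t :: real
  have cl: "cl t \<in> {0..1}" "s \<le> t \<Longrightarrow> cl s \<le> cl t" for s t by (auto simp: cl_def)
  define f where "f t = u t + C * t" for t
  define F where "F t = root_series q (cl t) + f (cl t)" for t
  have f_mono: "f s \<le> f t" if "s \<le> t" "s \<in> {0..1}" "t \<in> {0..1}" for s t
    using lipschitz_onD[OF u that(3,2)] that(1) by (simp add: f_def dist_real_def algebra_simps)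
  have mono_v: "root_series q s \<le> root_series q t" if "s \<le> t" for s t
    using monoD[OF root_series_mono[where q = q, OF q] that] .
  have "mono F"
    unfolding F_def by (intro monoI add_mono mono_v f_mono cl)
  moreover have "continuous_on UNIV F"
  proof -
    have "continuous_on UNIV cl" unfolding cl_def by (intro continuous_intros)
    moreover have "continuous_on {0..1} (\<lambda>t. root_series q t + f t)"
      unfolding f_def
      by (intro continuous_intros lipschitz_on_continuous_on[OF u]
          continuous_on_subset[OF abs_continuous_on_imp_continuous[OF root_series_abs_continuous[where q = q, OF q]]]) auto
    ultimately show ?thesis unfolding F_def
      by (intro continuous_on_compose2[where g = "\<lambda>t. root_series q t + f t" and f = cl]) (use cl in auto)
  qed
  ultimately have "AE x in lebesgue. F differentiable (at x)"
    by (intro AE_completion mono_continuous_AE_differentiable)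
  then show ?thesis
  proof eventually_elim
    case (elim x)
    then obtain D where D: "(F has_real_derivative D) (at x)" unfolding real_differentiable_def by blast
    show ?case
    proof
      assume x: "q n < x \<and> 0 < x \<and> x < 1"
      have eq: "F t = root_series q t + f t" if "t \<in> {0<..<1}" for t
        using that by (auto simp: F_def cl_def)
      have "((\<lambda>t. F t - C * t) has_real_derivative D - C) (at x)"
        using D by (auto intro!: derivative_eq_intros)
      then have "((\<lambda>t. root_series q t + u t) has_real_derivative D - C) (at x)"
        by (rule has_field_derivative_transform_within_open[of _ _ _ "{0<..<1}"])
           (use x eq in \<open>auto simp: f_def\<close>)
      then have deriv: "deriv (\<lambda>t. root_series q t + u t) x = D - C" by (rule DERIV_imp_deriv)
      have "mono_on {0<..<1} (\<lambda>t. F t - (1/2)^n * pos_sqrt (t - q n))"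
      proof (rule mono_onI)
        fix s t :: real assume st: "s \<in> {0<..<1}" "t \<in> {0<..<1}" "s \<le> t"
        then show "F s - (1/2)^n * pos_sqrt (s - q n) \<le> F t - (1/2)^n * pos_sqrt (t - q n)"
          using root_series_increment[where q = q and n = n, OF q st(3)] f_mono[of s t] eq
          by (simp add: right_diff_distrib)
      qed
      moreover have "((\<lambda>t. F t - (1/2)^n * pos_sqrt (t - q n)) has_real_derivative
          D - (1/2)^n * (1 / (2 * sqrt (x - q n)))) (at x)"
        using x by (intro DERIV_diff D DERIV_cmult DERIV_pos_sqrt) auto
      ultimately have "0 \<le> D - (1/2)^n * (1 / (2 * sqrt (x - q n)))"
        by (rule mono_on_imp_deriv_nonneg) (use x in \<open>auto simp: interior_open\<close>)
      then show "(1/2)^n / (2 * sqrt (x - q n)) - C \<le> deriv (\<lambda>t. root_series q t + u t) x"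
        by (simp add: deriv)
    qed
  qed
qed

text \<open>
  Near \<open>t0\<close> the weight \<open>\<bar>u\<bar>\<close> is at least some \<open>c > 0\<close>, and some \<open>q n\<close> lies there. On
  \<open>{q n<..<q n + \<epsilon>}\<close> the derivative is at least of order \<open>1 / sqrt \<epsilon>\<close>, whatever the
  Lipschitz constant of \<open>u\<close>. Its fourth power, of order \<open>1 / \<epsilon>\<^sup>2\<close>, contributes at least a
  multiple of \<open>1 / \<epsilon>\<close> on an interval of length \<open>\<epsilon>\<close>, and \<open>\<epsilon>\<close> is arbitrarily small.
\<close>

lemma nonzero_perturbation_infinite_energy:
  assumes q: "\<And>n. 0 \<le> q n" and dense: "\<And>a b. 0 \<le> a \<Longrightarrow> a < b \<Longrightarrow> \<exists>n. q n \<in> {a<..<b}"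
    and u: "u \<in> W1inf_0" "t0 \<in> {0..1}" "u t0 \<noteq> 0"
  shows "energy (\<lambda>t y p. \<bar>y - root_series q t\<bar> * p ^ 4) (\<lambda>t. root_series q t + u t) = \<infinity>"
proof -
  obtain C where C: "C-lipschitz_on {0..1} u" and u01: "u 0 = 0" "u 1 = 0"
    using u(1) unfolding W1inf_0_def by blast
  have C0: "0 \<le> C" using C by (rule lipschitz_on_nonneg)
  define c where "c = \<bar>u t0\<bar> / 2"
  have c: "0 < c" using u(3) by (simp add: c_def)
  have "t0 \<noteq> 0" "t0 \<noteq> 1" using u(3) u01 by auto
  then have t0: "0 < t0" "t0 < 1" using u(2) by auto
  have "continuous_on {0..1} u" using C by (rule lipschitz_on_continuous_on)
  then obtain \<rho> where \<rho>: "0 < \<rho>" "\<And>t. t \<in> {0..1} \<Longrightarrow> \<bar>t - t0\<bar> < \<rho> \<Longrightarrow> \<bar>u t - u t0\<bar> < c"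
    using c u(2) unfolding continuous_on_iff dist_real_def by metis
  define b where "b = min 1 (t0 + \<rho>)"
  have b: "t0 < b" "b \<le> 1" "b \<le> t0 + \<rho>" using t0 \<rho>(1) by (auto simp: b_def)
  obtain n where n: "t0 < q n" "q n < b" using dense[of t0 b] t0 b by auto
  have u_ge: "c \<le> \<bar>u t\<bar>" if "t \<in> {t0<..<b}" for t
  proof -
    have "\<bar>u t - u t0\<bar> < c" using that b t0 by (intro \<rho>(2)) auto
    then show ?thesis unfolding c_def by linarith
  qed
  \<comment> \<open>The derivative of the \<open>n\<close>-th term at \<open>q n + s\<close> is \<open>2 * K / sqrt s\<close>; one half of it absorbs the
    Lipschitz constant \<open>C\<close>.\<close>
  define K where "K = (1/2::real)^n / 4"
  have K: "0 < K" by (simp add: K_def)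
  define E where "E = energy (\<lambda>t y p. \<bar>y - root_series q t\<bar> * p ^ 4) (\<lambda>t. root_series q t + u t)"
  have lower: "ennreal (c * K ^ 4 / \<epsilon>) \<le> E" if \<epsilon>: "0 < \<epsilon>" "\<epsilon> < b - q n" "sqrt \<epsilon> * C \<le> K" for \<epsilon>
  proof -
    have "ennreal (c * K ^ 4 / \<epsilon>) = (\<integral>\<^sup>+t. ennreal (c * (K / sqrt \<epsilon>) ^ 4) * indicator {q n<..<q n + \<epsilon>} t \<partial>lebesgue)"
    proof -
      have "(sqrt \<epsilon>) ^ 4 = \<epsilon> * \<epsilon>" using \<epsilon>(1) by (simp add: power4_eq_xxxx)
      then have "c * (K / sqrt \<epsilon>) ^ 4 * \<epsilon> = c * K ^ 4 / \<epsilon>" using \<epsilon>(1) by (simp add: power_divide)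
      then show ?thesis using \<epsilon>(1) c K by (simp add: nn_integral_cmult_indicator flip: ennreal_mult)
    qed
    also have "\<dots> \<le> E"
      unfolding E_def energy_def
    proof (rule nn_integral_mono_AE)
      show "AE t in lebesgue. ennreal (c * (K / sqrt \<epsilon>) ^ 4) * indicator {q n<..<q n + \<epsilon>} t
        \<le> ennreal (\<bar>root_series q t + u t - root_series q t\<bar> * deriv (\<lambda>t. root_series q t + u t) t ^ 4)
          * indicator {0..1} t"
        using AE_deriv_root_series_plus_Lipschitz[where q = q and n = n, OF q C]
      proof eventually_elim
        case (elim t)
        show ?case
        proof (cases "t \<in> {q n<..<q n + \<epsilon>}")
          case True
          then have t: "t \<in> {t0<..<b}" "0 < t" "t < 1" "q n < t" "t - q n < \<epsilon>"
            using n \<epsilon> b t0 by auto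
          define d where "d = deriv (\<lambda>t. root_series q t + u t) t"
          have "C \<le> K / sqrt \<epsilon>" using \<epsilon>(1,3) by (simp add: pos_le_divide_eq mult.commute)
          then have "K / sqrt \<epsilon> + C \<le> 2 * K / sqrt \<epsilon>" by simp
          also have "\<dots> \<le> 2 * K / sqrt (t - q n)"
            using t K \<epsilon> by (intro divide_left_mono) auto
          also have "\<dots> = (1/2)^n / (2 * sqrt (t - q n))" by (simp add: K_def)
          finally have "K / sqrt \<epsilon> \<le> d" using elim t unfolding d_def by linarith
          then have "(K / sqrt \<epsilon>) ^ 4 \<le> d ^ 4" using K \<epsilon> by (intro power_mono) auto
          then have "c * (K / sqrt \<epsilon>) ^ 4 \<le> \<bar>u t\<bar> * d ^ 4"
            using c u_ge[OF t(1)] by (intro mult_mono) auto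
          then show ?thesis using True t by (simp add: d_def ennreal_leI)
        qed simp
      qed
    qed
    finally show ?thesis .
  qed
  have "ennreal r \<le> E" if "0 < r" for r
  proof -
    define \<epsilon> where "\<epsilon> = Min {(b - q n) / 2, (K / (C + 1))\<^sup>2, c * K ^ 4 / r}"
    have \<epsilon>: "0 < \<epsilon>" "\<epsilon> \<le> (b - q n) / 2" "\<epsilon> \<le> (K / (C + 1))\<^sup>2" "\<epsilon> \<le> c * K ^ 4 / r"
      using n c K C0 that by (simp_all add: \<epsilon>_def min.coboundedI1 min.coboundedI2 del: divide_le_eq_numeral1 le_divide_eq_numeral1)
    have "sqrt \<epsilon> \<le> K / (C + 1)" using real_sqrt_le_mono[OF \<epsilon>(3)] K C0 by simp
    then have "sqrt \<epsilon> * (C + 1) \<le> K" using C0 by (simp add: pos_le_divide_eq)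
    moreover have "0 \<le> sqrt \<epsilon>" using \<epsilon>(1) by simp
    ultimately have "sqrt \<epsilon> * C \<le> K" unfolding distrib_left by linarith
    then have "ennreal (c * K ^ 4 / \<epsilon>) \<le> E" using \<epsilon> n by (intro lower) auto
    moreover have "r \<le> c * K ^ 4 / \<epsilon>" using \<epsilon>(1,4) that by (simp add: field_simps)
    ultimately show ?thesis by (meson ennreal_leI order_trans)
  qed
  have "E = \<infinity>"
  proof (rule ccontr)
    assume "E \<noteq> \<infinity>"
    then obtain s where s: "0 \<le> s" "E = ennreal s" by (cases E) auto
    with \<open>\<And>r. 0 < r \<Longrightarrow> ennreal r \<le> E\<close>[of "s + 1"] show False by simp
  qed
  then show ?thesis by (simp add: E_def)
qed

theorem theorem17:
  shows "\<exists>(v :: real \<Rightarrow> real) (L :: real \<Rightarrow> real \<Rightarrow> real \<Rightarrow> real).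
    v \<in> W11 \<and>
    continuous_on ({0..1} \<times> UNIV \<times> UNIV) (\<lambda>(t, y, p). L t y p) \<and>
    (\<forall>t\<in>{0..1}. \<forall>y p. 0 \<le> L t y p) \<and>
    (\<forall>t\<in>{0..1}. \<forall>y. convex_on UNIV (\<lambda>p. L t y p)) \<and>
    is_minimizer L (v 0) (v 1) v \<and>
    0 \<le> energy L v \<and> energy L v < \<infinity> \<and>
    (\<forall>u\<in>W1inf_0. (\<exists>t\<in>{0..1}. u t \<noteq> 0) \<longrightarrow> energy L (\<lambda>t. v t + u t) = \<infinity>)"
proof -
  define A where "A = {x \<in> \<rat>. 0 \<le> (x::real)}"
  define q where "q = from_nat_into A"
  have "0 \<in> A" "countable A"
    unfolding A_def by (auto intro: countable_subset[OF _ countable_rat])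
  then have range_q: "range q = A" unfolding q_def by (intro range_from_nat_into) auto
  have q: "0 \<le> q n" for n using rangeI[of q n] unfolding range_q by (simp add: A_def)
  have dense: "\<exists>n. q n \<in> {a<..<b}" if "0 \<le> a" "a < b" for a b
  proof -
    obtain x where "x \<in> \<rat>" "a < x" "x < b" using Rats_dense_in_real[OF \<open>a < b\<close>] by blast
    then have "x \<in> range q" "x \<in> {a<..<b}" unfolding range_q using \<open>0 \<le> a\<close> by (auto simp: A_def)
    then show ?thesis by blast
  qed
  define v where "v = root_series q"
  define L where "L = (\<lambda>t y p. \<bar>y - v t\<bar> * p ^ 4)"
  have ac: "abs_continuous_on UNIV v" unfolding v_def by (rule root_series_abs_continuous[where q = q, OF q])
  have "v \<in> W11" using abs_continuous_on_subset[OF ac] by (simp add: W11_def)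
  moreover have "continuous_on ({0..1} \<times> UNIV \<times> UNIV) (\<lambda>(t, y, p). L t y p)"
    unfolding L_def split_def
    by (intro continuous_intros continuous_on_compose2[OF abs_continuous_on_imp_continuous[OF ac]]) auto
  moreover have "\<forall>t\<in>{0..1}. \<forall>y. convex_on UNIV (\<lambda>p. L t y p)"
    unfolding L_def by (intro ballI allI convex_on_cmul convex_power_even) auto
  moreover have zero: "energy L v = 0" by (simp add: energy_def L_def)
  moreover from \<open>v \<in> W11\<close> zero have "is_minimizer L (v 0) (v 1) v"
    by (simp add: is_minimizer_def admissible_def)
  moreover have "energy L (\<lambda>t. v t + u t) = \<infinity>" if "u \<in> W1inf_0" "t \<in> {0..1}" "u t \<noteq> 0" for u t
    unfolding L_def v_def by (rule nonzero_perturbation_infinite_energy[OF q dense that])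
  moreover have "\<forall>t\<in>{0..1}. \<forall>y p. 0 \<le> L t y p" by (simp add: L_def)
  ultimately show ?thesis by (intro exI[of _ v] exI[of _ L]) auto
qed

end
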